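(* Let $V$ be a real affine algebraic variety defined over a countable field $k\subset\mathbb{R}$, let $(f_j)_{j\in J}$ be a generating family for $V$ and let $s\in\{-1,1\}^J$. Then $$CB(V_s)\subset\bigcap_{f\in I}T_{\mathbb{R}}(f_0^+,f_0^-),$$ that is, for every $f\in I$ every point $x=(x_j)_{j\in J}\in CB(V_s)\subset\mathbb{R}^J$ satisfies $$\max_{\omega\in A_{f,s}^+}\langle x,\omega\rangle=\max_{\omega\in A_{f,s}^-}\langle x,\omega\rangle .$$
   Context: $k[V]$ is the ring of polynomial functions on $V$ with coefficients in $k$. A generating family is a family $(f_j)_{j\in J}$ of elements of $k[V]$, with $J$ finite or countable, whose elements generate $k[V]$ as a $k$-algebra. Put $V'=\{x\in V: f_j(x)\neq 0\ \forall j\in J\}$, $V_s=\{x\in V: s_jf_j(x)>0\ \forall j\in J\}$ and $\mathrm{Log}:V'\to\mathbb{R}^J$, $x\mapsto(\log|f_j(x)|)_{j\in J}$. The space $\mathbb{R}^J$ has the product topology, $\mathcal{S}=(\mathbb{R}^J\setminus\{0\})/\mathbb{R}_{>0}$ has the quotient topology, and $\pi:\mathbb{R}^J\setminus\{0\}\to\mathcal{S}$ is the projection. The boundary $B(V_s)\subset\mathcal{S}$ is the set of $b\in\mathcal{S}$ for which there is a sequence $(x_n)\subset V_s$, eventually leaving every compact subset of $V'$ (classical topology), with $\pi(\mathrm{Log}(x_n))\to b$. The cone over it is $CB(V_s)=\{0\}\cup\pi^{-1}(B(V_s))$ if $V_s\ne\emptyset$, and $CB(V_s)=\emptyset$ if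 $V_s=\emptyset$. $k[V']$ is the localization of $k[V]$ at the multiplicative set generated by the $f_j$, and $I$ is the kernel of the $k$-algebra homomorphism $k[(X_j),(X_j^{-1})]\to k[V']$, $X_j\mapsto f_j$, defined on the Laurent polynomial ring in the variables $(X_j)_{j\in J}$. Elements of $I$ are written $f=\sum_{\omega\in\mathbb{Z}^{\oplus J}}a_\omega X^\omega$ with $X^\omega=\prod_jX_j^{\omega_j}$, and $A_f=\{\omega:a_\omega\ne0\}$ is finite. $A_{f,s}^{+}$ (resp. $A_{f,s}^-$) is the set of $\omega\in A_f$ such that $a_\omega\prod_js_j^{\omega_j}$ is positive (resp. negative), i.e. such that the monomial $a_\omega X^\omega$ is positive (resp. negative) at $(f_j(x))_j$ for $x\in V_s$. For $x\in\mathbb{R}^J$, $\langle x,\omega\rangle=\sum_jx_j\omega_j$; $f_0^{\pm}(x)=\max_{\omega\in A_{f,s}^{\pm}}\langle x,\omega\rangle$ (maximum of the empty set is $-\infty$), and $T_{\mathbb{R}}(f_0^+,f_0^-)=\{x\in\mathbb{R}^J: f_0^+(x)=f_0^-(x)\}$. *)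

theory Defs
  imports
    "HOL-Analysis.Analysis"
    "HOL-Library.Poly_Mapping"
    "HOL-Algebra.Generated_Rings"
    "HOL-Algebra.Algebraic_Closure_Type"
begin

section \<open>Varieties and polynomial functions\<close>

text \<open>
  Real affine $n$-space and the space $\mathbb{R}^J$ are both rendered by
  \<^const>\<open>powertop_real\<close>: their points are extensional functions on the index
  set, so that $n = 0$ and $J = \emptyset$ are not excluded. A polynomial is a finitely
  supported map from exponents to coefficients.
\<close>

definition mpolys :: "real set \<Rightarrow> nat \<Rightarrow> ((nat \<Rightarrow>\<^sub>0 nat) \<Rightarrow>\<^sub>0 real) set" where
  "mpolys K n = {p. \<forall>m\<in>Poly_Mapping.keys p. Poly_Mapping.keys m \<subseteq> {..<n} \<and> Poly_Mapping.lookup p m \<in> K}"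

definition mpoly_eval :: "((nat \<Rightarrow>\<^sub>0 nat) \<Rightarrow>\<^sub>0 real) \<Rightarrow> (nat \<Rightarrow> real) \<Rightarrow> real" where
  "mpoly_eval p x = (\<Sum>m\<in>Poly_Mapping.keys p. Poly_Mapping.lookup p m * (\<Prod>i\<in>Poly_Mapping.keys m. x i ^ Poly_Mapping.lookup m i))"

definition affine_variety :: "real set \<Rightarrow> nat \<Rightarrow> (nat \<Rightarrow> real) set \<Rightarrow> bool" where
  "affine_variety K n V \<longleftrightarrow>
     (\<exists>P\<subseteq>mpolys K n. V = {x \<in> topspace (powertop_real {..<n}). \<forall>p\<in>P. mpoly_eval p x = 0})"

definition const_on :: "(nat \<Rightarrow> real) set \<Rightarrow> real \<Rightarrow> (nat \<Rightarrow> real) \<Rightarrow> real" where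
  "const_on V c = (\<lambda>x\<in>V. c)"

definition coord_ring :: "real set \<Rightarrow> nat \<Rightarrow> (nat \<Rightarrow> real) set \<Rightarrow> ((nat \<Rightarrow> real) \<Rightarrow> real) ring" where
  "coord_ring K n V =
     \<lparr>carrier = (\<lambda>p. restrict (mpoly_eval p) V) ` mpolys K n,
      mult = (\<lambda>g h. \<lambda>x\<in>V. g x * h x), one = const_on V 1,
      zero = const_on V 0, add = (\<lambda>g h. \<lambda>x\<in>V. g x + h x)\<rparr>"

text \<open>The subring generated by the constants and the \<open>f j\<close> is the $k$-algebra generated by the \<open>f j\<close>.\<close>

definition generating_family ::
    "real set \<Rightarrow> nat \<Rightarrow> (nat \<Rightarrow> real) set \<Rightarrow> 'j set \<Rightarrow> ('j \<Rightarrow> (nat \<Rightarrow> real) \<Rightarrow> real) \<Rightarrow> bool" where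
  "generating_family K n V J f \<longleftrightarrow>
     countable J \<and> f \<in> J \<rightarrow> carrier (coord_ring K n V) \<and>
     generate_ring (coord_ring K n V) (const_on V ` K \<union> f ` J) = carrier (coord_ring K n V)"


section \<open>Localization of a commutative ring at a multiplicative set\<close>

definition loc_rel :: "('a, 'b) ring_scheme \<Rightarrow> 'a set \<Rightarrow> (('a \<times> 'a) \<times> ('a \<times> 'a)) set" where
  "loc_rel R S = {((a, u), (b, v)). a \<in> carrier R \<and> u \<in> S \<and> b \<in> carrier R \<and> v \<in> S \<and>
     (\<exists>t\<in>S. t \<otimes>\<^bsub>R\<^esub> (a \<otimes>\<^bsub>R\<^esub> v) = t \<otimes>\<^bsub>R\<^esub> (b \<otimes>\<^bsub>R\<^esub> u))}"

definition loc_frac :: "('a, 'b) ring_scheme \<Rightarrow> 'a set \<Rightarrow> 'a \<Rightarrow> 'a \<Rightarrow> ('a \<times> 'a) set" where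
  "loc_frac R S a u = loc_rel R S `` {(a, u)}"

definition localization :: "('a, 'b) ring_scheme \<Rightarrow> 'a set \<Rightarrow> ('a \<times> 'a) set ring" where
  "localization R S =
     \<lparr>carrier = (carrier R \<times> S) // loc_rel R S,
      mult = (\<lambda>A B. \<Union>p\<in>A. \<Union>q\<in>B.
                loc_frac R S (fst p \<otimes>\<^bsub>R\<^esub> fst q) (snd p \<otimes>\<^bsub>R\<^esub> snd q)),
      one = loc_frac R S \<one>\<^bsub>R\<^esub> \<one>\<^bsub>R\<^esub>,
      zero = loc_frac R S \<zero>\<^bsub>R\<^esub> \<one>\<^bsub>R\<^esub>,
      add = (\<lambda>A B. \<Union>p\<in>A. \<Union>q\<in>B.
               loc_frac R S (fst p \<otimes>\<^bsub>R\<^esub> snd q \<oplus>\<^bsub>R\<^esub> fst q \<otimes>\<^bsub>R\<^esub> snd p)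
                 (snd p \<otimes>\<^bsub>R\<^esub> snd q))\<rparr>"

inductive_set mult_generated :: "('a, 'b) monoid_scheme \<Rightarrow> 'a set \<Rightarrow> 'a set" for R and H where
  one: "\<one>\<^bsub>R\<^esub> \<in> mult_generated R H"
| incl: "h \<in> H \<Longrightarrow> h \<in> mult_generated R H"
| mult: "g \<in> mult_generated R H \<Longrightarrow> h \<in> mult_generated R H \<Longrightarrow> g \<otimes>\<^bsub>R\<^esub> h \<in> mult_generated R H"


section \<open>The ideal of Laurent relations\<close>

definition laurent_polys :: "real set \<Rightarrow> 'j set \<Rightarrow> (('j \<Rightarrow>\<^sub>0 int) \<Rightarrow>\<^sub>0 real) set" where
  "laurent_polys K J = {a. \<forall>\<omega>\<in>Poly_Mapping.keys a. Poly_Mapping.keys \<omega> \<subseteq> J \<and> Poly_Mapping.lookup a \<omega> \<in> K}"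

definition coord_ring_loc ::
    "real set \<Rightarrow> nat \<Rightarrow> (nat \<Rightarrow> real) set \<Rightarrow> 'j set \<Rightarrow> ('j \<Rightarrow> (nat \<Rightarrow> real) \<Rightarrow> real)
     \<Rightarrow> (((nat \<Rightarrow> real) \<Rightarrow> real) \<times> ((nat \<Rightarrow> real) \<Rightarrow> real)) set ring" where
  "coord_ring_loc K n V J f =
     localization (coord_ring K n V) (mult_generated (coord_ring K n V) (f ` J))"

definition to_coord_ring_loc ::
    "real set \<Rightarrow> nat \<Rightarrow> (nat \<Rightarrow> real) set \<Rightarrow> 'j set \<Rightarrow> ('j \<Rightarrow> (nat \<Rightarrow> real) \<Rightarrow> real)
     \<Rightarrow> ((nat \<Rightarrow> real) \<Rightarrow> real) \<Rightarrow> (((nat \<Rightarrow> real) \<Rightarrow> real) \<times> ((nat \<Rightarrow> real) \<Rightarrow> real)) set" where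
  "to_coord_ring_loc K n V J f g =
     loc_frac (coord_ring K n V) (mult_generated (coord_ring K n V) (f ` J)) g \<one>\<^bsub>coord_ring K n V\<^esub>"

text \<open>
  The $k$-algebra homomorphism $X_j \mapsto f_j$; negative powers are powers of the inverse
  of \<open>f j\<close> in the localization.
\<close>

definition laurent_hom ::
    "real set \<Rightarrow> nat \<Rightarrow> (nat \<Rightarrow> real) set \<Rightarrow> 'j set \<Rightarrow> ('j \<Rightarrow> (nat \<Rightarrow> real) \<Rightarrow> real)
     \<Rightarrow> (('j \<Rightarrow>\<^sub>0 int) \<Rightarrow>\<^sub>0 real) \<Rightarrow> (((nat \<Rightarrow> real) \<Rightarrow> real) \<times> ((nat \<Rightarrow> real) \<Rightarrow> real)) set" where
  "laurent_hom K n V J f a =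
     (let L = coord_ring_loc K n V J f; \<iota> = to_coord_ring_loc K n V J f in
      \<Oplus>\<^bsub>L\<^esub>\<omega>\<in>Poly_Mapping.keys a. \<iota> (const_on V (Poly_Mapping.lookup a \<omega>)) \<otimes>\<^bsub>L\<^esub>
        (\<Otimes>\<^bsub>L\<^esub>j\<in>Poly_Mapping.keys \<omega>. \<iota> (f j) [^]\<^bsub>L\<^esub> Poly_Mapping.lookup \<omega> j))"

definition relation_ideal ::
    "real set \<Rightarrow> nat \<Rightarrow> (nat \<Rightarrow> real) set \<Rightarrow> 'j set \<Rightarrow> ('j \<Rightarrow> (nat \<Rightarrow> real) \<Rightarrow> real)
     \<Rightarrow> (('j \<Rightarrow>\<^sub>0 int) \<Rightarrow>\<^sub>0 real) set" where
  "relation_ideal K n V J f =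
     {a \<in> laurent_polys K J. laurent_hom K n V J f a = \<zero>\<^bsub>coord_ring_loc K n V J f\<^esub>}"


section \<open>The space of directions\<close>

definition quotient_topology :: "'a topology \<Rightarrow> ('a \<Rightarrow> 'b) \<Rightarrow> 'b topology" where
  "quotient_topology T q =
     topology (\<lambda>U. U \<subseteq> q ` topspace T \<and> openin T {x \<in> topspace T. q x \<in> U})"

lemma openin_quotient_topology:
  "openin (quotient_topology T q) U \<longleftrightarrow>
     U \<subseteq> q ` topspace T \<and> openin T {x \<in> topspace T. q x \<in> U}"
proof -
  have "istopology (\<lambda>U. U \<subseteq> q ` topspace T \<and> openin T {x \<in> topspace T. q x \<in> U})"
    unfolding istopology_def
  proof (intro conjI allI impI)
    fix G H
    assume G: "G \<subseteq> q ` topspace T \<and> openin T {x \<in> topspace T. q x \<in> G}"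
      and H: "H \<subseteq> q ` topspace T \<and> openin T {x \<in> topspace T. q x \<in> H}"
    have eq: "{x \<in> topspace T. q x \<in> G \<inter> H} =
        {x \<in> topspace T. q x \<in> G} \<inter> {x \<in> topspace T. q x \<in> H}" by blast
    show "openin T {x \<in> topspace T. q x \<in> G \<inter> H}"
      unfolding eq using G H by (intro openin_Int) simp_all
    show "G \<inter> H \<subseteq> q ` topspace T" using G by blast
  next
    fix \<K>
    assume K: "\<forall>U\<in>\<K>. U \<subseteq> q ` topspace T \<and> openin T {x \<in> topspace T. q x \<in> U}"
    have eq: "{x \<in> topspace T. q x \<in> \<Union>\<K>} = \<Union>((\<lambda>U. {x \<in> topspace T. q x \<in> U}) ` \<K>)"
      by blast
    show "openin T {x \<in> topspace T. q x \<in> \<Union>\<K>}"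
      unfolding eq by (rule openin_Union) (use K in blast)
    show "\<Union>\<K> \<subseteq> q ` topspace T" using K by blast
  qed
  then show ?thesis by (simp add: quotient_topology_def topology_inverse')
qed

lemma topspace_quotient_topology: "topspace (quotient_topology T q) = q ` topspace T"
proof
  show "topspace (quotient_topology T q) \<subseteq> q ` topspace T"
    using openin_quotient_topology[of T q] openin_topspace by blast
  have "{x \<in> topspace T. q x \<in> q ` topspace T} = topspace T" by blast
  then have "openin (quotient_topology T q) (q ` topspace T)"
    by (simp add: openin_quotient_topology)
  then show "q ` topspace T \<subseteq> topspace (quotient_topology T q)"
    by (rule openin_subset)
qed

lemma quotient_map_quotient_topology: "quotient_map T (quotient_topology T q) q"
  by (simp add: quotient_map_def openin_quotient_topology topspace_quotient_topology)

definition origin :: "'j set \<Rightarrow> 'j \<Rightarrow> real" where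
  "origin J = (\<lambda>j\<in>J. 0)"

definition punctured_space :: "'j set \<Rightarrow> ('j \<Rightarrow> real) topology" where
  "punctured_space J =
     subtopology (powertop_real J) (topspace (powertop_real J) - {origin J})"

text \<open>
  Points of the direction space are the orbits under positive scaling. The orbit of the
  origin is not one of them, so a sequence of orbits that converges in this space is eventually
  a sequence of orbits of nonzero vectors.
\<close>

definition ray :: "'j set \<Rightarrow> ('j \<Rightarrow> real) \<Rightarrow> ('j \<Rightarrow> real) set" where
  "ray J v = {w. \<exists>c>0. w = (\<lambda>j\<in>J. c * v j)}"

definition direction_space :: "'j set \<Rightarrow> ('j \<Rightarrow> real) set topology" where
  "direction_space J = quotient_topology (punctured_space J) (ray J)"


section \<open>The boundary and its cone\<close>

definition nonvanishing_locus ::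
    "(nat \<Rightarrow> real) set \<Rightarrow> 'j set \<Rightarrow> ('j \<Rightarrow> (nat \<Rightarrow> real) \<Rightarrow> real) \<Rightarrow> (nat \<Rightarrow> real) set" where
  "nonvanishing_locus V J f = {x \<in> V. \<forall>j\<in>J. f j x \<noteq> 0}"

definition sign_locus ::
    "(nat \<Rightarrow> real) set \<Rightarrow> 'j set \<Rightarrow> ('j \<Rightarrow> (nat \<Rightarrow> real) \<Rightarrow> real) \<Rightarrow> ('j \<Rightarrow> real) \<Rightarrow> (nat \<Rightarrow> real) set" where
  "sign_locus V J f s = {x \<in> V. \<forall>j\<in>J. s j * f j x > 0}"

definition Log_map ::
    "'j set \<Rightarrow> ('j \<Rightarrow> (nat \<Rightarrow> real) \<Rightarrow> real) \<Rightarrow> (nat \<Rightarrow> real) \<Rightarrow> ('j \<Rightarrow> real)" where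
  "Log_map J f x = (\<lambda>j\<in>J. ln \<bar>f j x\<bar>)"

definition sign_boundary ::
    "nat \<Rightarrow> (nat \<Rightarrow> real) set \<Rightarrow> 'j set \<Rightarrow> ('j \<Rightarrow> (nat \<Rightarrow> real) \<Rightarrow> real) \<Rightarrow> ('j \<Rightarrow> real)
     \<Rightarrow> ('j \<Rightarrow> real) set set" where
  "sign_boundary n V J f s =
     {b \<in> topspace (direction_space J). \<exists>x::nat \<Rightarrow> nat \<Rightarrow> real.
        (\<forall>i. x i \<in> sign_locus V J f s) \<and>
        (\<forall>C. compactin (subtopology (powertop_real {..<n}) (nonvanishing_locus V J f)) C \<longrightarrow>
           (\<forall>\<^sub>F i in sequentially. x i \<notin> C)) \<and>
        limitin (direction_space J) (\<lambda>i. ray J (Log_map J f (x i))) b sequentially}"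

definition sign_cone ::
    "nat \<Rightarrow> (nat \<Rightarrow> real) set \<Rightarrow> 'j set \<Rightarrow> ('j \<Rightarrow> (nat \<Rightarrow> real) \<Rightarrow> real) \<Rightarrow> ('j \<Rightarrow> real)
     \<Rightarrow> ('j \<Rightarrow> real) set" where
  "sign_cone n V J f s =
     (if sign_locus V J f s = {} then {}
      else {origin J} \<union>
        {v \<in> topspace (punctured_space J). ray J v \<in> sign_boundary n V J f s})"


section \<open>Signed tropicalization\<close>

definition pos_exponents :: "('j \<Rightarrow> real) \<Rightarrow> (('j \<Rightarrow>\<^sub>0 int) \<Rightarrow>\<^sub>0 real) \<Rightarrow> ('j \<Rightarrow>\<^sub>0 int) set" where
  "pos_exponents s a = {\<omega> \<in> Poly_Mapping.keys a. Poly_Mapping.lookup a \<omega> * (\<Prod>j\<in>Poly_Mapping.keys \<omega>. s j powi Poly_Mapping.lookup \<omega> j) > 0}"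

definition neg_exponents :: "('j \<Rightarrow> real) \<Rightarrow> (('j \<Rightarrow>\<^sub>0 int) \<Rightarrow>\<^sub>0 real) \<Rightarrow> ('j \<Rightarrow>\<^sub>0 int) set" where
  "neg_exponents s a = {\<omega> \<in> Poly_Mapping.keys a. Poly_Mapping.lookup a \<omega> * (\<Prod>j\<in>Poly_Mapping.keys \<omega>. s j powi Poly_Mapping.lookup \<omega> j) < 0}"

definition pairing :: "('j \<Rightarrow> real) \<Rightarrow> ('j \<Rightarrow>\<^sub>0 int) \<Rightarrow> real" where
  "pairing x \<omega> = (\<Sum>j\<in>Poly_Mapping.keys \<omega>. x j * of_int (Poly_Mapping.lookup \<omega> j))"

definition max_pairing :: "('j \<Rightarrow>\<^sub>0 int) set \<Rightarrow> ('j \<Rightarrow> real) \<Rightarrow> ereal" where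
  "max_pairing A x = (if A = {} then - \<infinity> else ereal (Max (pairing x ` A)))"

definition tropical_locus ::
    "'j set \<Rightarrow> (('j \<Rightarrow> real) \<Rightarrow> ereal) \<Rightarrow> (('j \<Rightarrow> real) \<Rightarrow> ereal) \<Rightarrow> ('j \<Rightarrow> real) set" where
  "tropical_locus J g h = {x \<in> topspace (powertop_real J). g x = h x}"

end

theory Submission
  imports Defs
begin

text \<open>
  The logarithm turns a relation among the $f_j$ into an equality of two sums of exponentials.
  A relation $\sum_\omega a_\omega X^\omega$ in $I$ vanishes at $(f_j(x))_j$ for every point
  $x$ of \<open>V'\<close>, because evaluation at $x$ extends to the localization. For $x \in V_s$ the
  value of $X^\omega$ there is $\prod_j s_j^{\omega_j}$ times
  $\exp \langle \mathrm{Log}(x), \omega \rangle$, so moving the negative terms to the other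
  side gives an equality between two sums of exponentials with positive coefficients, over
  $A^+$ on one side and over $A^-$ on the other (\<open>relation_balance\<close>).

  Every point $v$ of the cone is a limit of vectors $\mathrm{Log}(x_i)/t_i$ with $x_i \in V_s$
  and $t_i \to \infty$ (\<open>sign_cone_asymptotic\<close>). For the origin a constant sequence serves.
  For $v \neq 0$ convergence of directions gives the limit once the vectors are rescaled by one
  coordinate that does not vanish at $v$. That the scales $t_i$ tend to infinity is where the
  escape from compact subsets of \<open>V'\<close> and the generation of the coordinate ring enter:
  if the $f_j$ and $1/f_j$ are bounded on a set, then so are the coordinates, so the set is
  relatively compact in \<open>V'\<close>. In other words, $\mathrm{Log}$ is proper
  (\<open>Log_map_proper\<close>).

  As $t_i \to \infty$, a sum of exponentials $\exp(t_i \langle v_i, \omega \rangle)$ with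
  $v_i \to v$ and positive coefficients grows at the rate of its largest
  $\langle v, \omega \rangle$. Two equal sums therefore have the same largest exponent
  (\<open>max_pairing_le_of_exp_sum_le\<close>, used in both directions).
\<close>


section \<open>Homomorphisms into the ring of a field type\<close>

locale field_valued_hom = cring R for R (structure) +
  fixes h :: "'a \<Rightarrow> 'c::field"
  assumes hom: "h \<in> ring_hom R ring_of_type_algebra"
begin

lemma hom_simps [simp]:
  "\<lbrakk>a \<in> carrier R; b \<in> carrier R\<rbrakk> \<Longrightarrow> h (a \<otimes> b) = h a * h b"
  "\<lbrakk>a \<in> carrier R; b \<in> carrier R\<rbrakk> \<Longrightarrow> h (a \<oplus> b) = h a + h b"
  "h \<one> = 1"
  using hom by (auto simp: ring_hom_def ring_of_type_algebra_def)

lemma hom_zero [simp]: "h \<zero> = 0"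
proof -
  have "h \<zero> + h \<zero> = h \<zero> + 0"
    using hom_simps(2)[of \<zero> \<zero>] by (metis add_0_right l_zero zero_closed)
  then show ?thesis
    by (simp only: add_left_cancel)
qed

lemma hom_finsum:
  "finite A \<Longrightarrow> g \<in> A \<rightarrow> carrier R \<Longrightarrow> h (finsum R g A) = (\<Sum>x\<in>A. h (g x))"
  by (induction A rule: finite_induct) (auto simp: Pi_iff)

lemma hom_finprod:
  "finite A \<Longrightarrow> g \<in> A \<rightarrow> carrier R \<Longrightarrow> h (finprod R g A) = (\<Prod>x\<in>A. h (g x))"
  by (induction A rule: finite_induct) (auto simp: Pi_iff)

text \<open>
  Negative powers require a unit: otherwise the inverse on the left is an unspecified element.
\<close>

lemma hom_int_pow:
  assumes "x \<in> Units R"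
  shows "h (x [^] (z::int)) = h x powi z"
proof -
  have pow: "h (x [^] (m::nat)) = h x ^ m" for m
    using assms by (induction m) auto
  have inv: "h (inv y) = inverse (h y)" if "y \<in> Units R" for y
  proof -
    have "h y * h (inv y) = 1"
      using that hom_simps(1)[of y "inv y"] by (simp add: Units_closed)
    then show ?thesis
      by (metis inverse_unique)
  qed
  show ?thesis
    using assms by (simp add: int_pow_def2 pow inv Units_pow_closed power_int_def power_inverse del: pow_nat)
qed

end

section \<open>Localization and its universal property\<close>

locale localizable = cring R + submonoid S R for S and R (structure)
begin

lemma S_carrier [simp]: "u \<in> S \<Longrightarrow> u \<in> carrier R"
  using subset by blast

lemma equiv_loc_rel: "equiv (carrier R \<times> S) (loc_rel R S)"
proof (rule equivI)
  show "loc_rel R S \<subseteq> (carrier R \<times> S) \<times> (carrier R \<times> S)"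
    by (auto simp: loc_rel_def)
  show "refl_on (carrier R \<times> S) (loc_rel R S)"
    by (auto simp: refl_on_def loc_rel_def intro: one_closed)
  show "sym (loc_rel R S)"
    by (auto simp: sym_def loc_rel_def) metis
  show "trans (loc_rel R S)"
  proof (rule transI)
    fix p q r assume pq: "(p, q) \<in> loc_rel R S" and qr: "(q, r) \<in> loc_rel R S"
    obtain a u b v c w where [simp]: "p = (a, u)" "q = (b, v)" "r = (c, w)"
      by (cases p, cases q, cases r)
    have mem [simp]: "a \<in> carrier R" "b \<in> carrier R" "c \<in> carrier R" "u \<in> S" "v \<in> S" "w \<in> S"
      using pq qr by (auto simp: loc_rel_def)
    obtain t where [simp]: "t \<in> S" and t: "t \<otimes> (a \<otimes> v) = t \<otimes> (b \<otimes> u)"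
      using pq by (auto simp: loc_rel_def)
    obtain t' where [simp]: "t' \<in> S" and t': "t' \<otimes> (b \<otimes> w) = t' \<otimes> (c \<otimes> v)"
      using qr by (auto simp: loc_rel_def)
    have "(t \<otimes> t' \<otimes> v) \<otimes> (a \<otimes> w) = (t' \<otimes> w) \<otimes> (t \<otimes> (a \<otimes> v))"
      by (simp add: m_ac)
    also have "\<dots> = (t \<otimes> u) \<otimes> (t' \<otimes> (b \<otimes> w))"
      unfolding t by (simp add: m_ac)
    also have "\<dots> = (t \<otimes> t' \<otimes> v) \<otimes> (c \<otimes> u)"
      unfolding t' by (simp add: m_ac)
    \<comment> \<open>Both hypotheses contain \<open>v\<close> but the goal does not, so the witness carries
      \<open>v\<close> along with \<open>t\<close> and \<open>t'\<close>.\<close>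
    finally have "\<exists>t\<in>S. t \<otimes> (a \<otimes> w) = t \<otimes> (c \<otimes> u)"
      by (intro bexI[of _ "t \<otimes> t' \<otimes> v"]) auto
    then show "(p, r) \<in> loc_rel R S"
      by (simp add: loc_rel_def)
  qed
qed

lemma frac_eqI:
  assumes "t \<in> S" "t \<otimes> (a \<otimes> v) = t \<otimes> (b \<otimes> u)"
    and "a \<in> carrier R" "b \<in> carrier R" "u \<in> S" "v \<in> S"
  shows "loc_frac R S a u = loc_frac R S b v"
  unfolding loc_frac_def
  by (rule equiv_class_eq[OF equiv_loc_rel]) (use assms in \<open>auto simp: loc_rel_def\<close>)

lemma frac_eqI':
  assumes "a \<otimes> v = b \<otimes> u" "a \<in> carrier R" "b \<in> carrier R" "u \<in> S" "v \<in> S"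
  shows "loc_frac R S a u = loc_frac R S b v"
  by (rule frac_eqI[of \<one>]) (use assms in auto)

lemma frac_closed [simp]:
  assumes "a \<in> carrier R" "u \<in> S"
  shows "loc_frac R S a u \<in> carrier (localization R S)"
  using assms by (simp add: localization_def loc_frac_def quotientI)

lemma frac_cases:
  assumes "A \<in> carrier (localization R S)"
  obtains a u where "a \<in> carrier R" "u \<in> S" "A = loc_frac R S a u"
  using assms by (auto simp: localization_def loc_frac_def elim!: quotientE)

lemma mult_frac:
  assumes "a \<in> carrier R" "u \<in> S" "b \<in> carrier R" "v \<in> S"
  shows "loc_frac R S a u \<otimes>\<^bsub>localization R S\<^esub> loc_frac R S b v =
    loc_frac R S (a \<otimes> b) (u \<otimes> v)"
proof -
  let ?m = "\<lambda>p q. loc_frac R S (fst p \<otimes> fst q) (snd p \<otimes> snd q)"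
  have "congruent2 (loc_rel R S) (loc_rel R S) ?m"
  proof (rule congruent2_commuteI[OF equiv_loc_rel])
    show "?m y z = ?m z y" if "y \<in> carrier R \<times> S" "z \<in> carrier R \<times> S" for y z
      using that by (auto simp: m_comm)
    show "?m w y = ?m w z" if wyz: "w \<in> carrier R \<times> S" "(y, z) \<in> loc_rel R S" for y z w
    proof -
      obtain c x where w: "w = (c, x)" "c \<in> carrier R" "x \<in> S" using wyz(1) by (cases w) auto
      obtain a u b v t where yz: "y = (a, u)" "z = (b, v)" "a \<in> carrier R" "b \<in> carrier R"
        "u \<in> S" "v \<in> S" "t \<in> S" and t: "t \<otimes> (a \<otimes> v) = t \<otimes> (b \<otimes> u)"
        using wyz(2) by (auto simp: loc_rel_def)
      have "t \<otimes> ((c \<otimes> a) \<otimes> (x \<otimes> v)) = (c \<otimes> x) \<otimes> (t \<otimes> (a \<otimes> v))"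
        using w yz by (simp add: m_ac)
      also have "\<dots> = t \<otimes> ((c \<otimes> b) \<otimes> (x \<otimes> u))"
        unfolding t using w yz by (simp add: m_ac)
      finally show ?thesis
        using w yz by simp (rule frac_eqI[of t], simp_all)
    qed
  qed
  from UN_equiv_class2[OF equiv_loc_rel equiv_loc_rel this, of "(a, u)" "(b, v)"]
  show ?thesis using assms by (simp add: localization_def loc_frac_def)
qed

lemma add_frac:
  assumes "a \<in> carrier R" "u \<in> S" "b \<in> carrier R" "v \<in> S"
  shows "loc_frac R S a u \<oplus>\<^bsub>localization R S\<^esub> loc_frac R S b v =
    loc_frac R S (a \<otimes> v \<oplus> b \<otimes> u) (u \<otimes> v)"
proof -
  let ?m = "\<lambda>p q. loc_frac R S (fst p \<otimes> snd q \<oplus> fst q \<otimes> snd p) (snd p \<otimes> snd q)"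
  have "congruent2 (loc_rel R S) (loc_rel R S) ?m"
  proof (rule congruent2_commuteI[OF equiv_loc_rel])
    show "?m y z = ?m z y" if "y \<in> carrier R \<times> S" "z \<in> carrier R \<times> S" for y z
      using that by (auto simp: m_comm a_comm)
    show "?m w y = ?m w z" if wyz: "w \<in> carrier R \<times> S" "(y, z) \<in> loc_rel R S" for y z w
    proof -
      obtain c x where w: "w = (c, x)" "c \<in> carrier R" "x \<in> S" using wyz(1) by (cases w) auto
      obtain a u b v t where yz: "y = (a, u)" "z = (b, v)" "a \<in> carrier R" "b \<in> carrier R"
        "u \<in> S" "v \<in> S" "t \<in> S" and t: "t \<otimes> (a \<otimes> v) = t \<otimes> (b \<otimes> u)"
        using wyz(2) by (auto simp: loc_rel_def)
      have "t \<otimes> ((c \<otimes> u \<oplus> a \<otimes> x) \<otimes> (x \<otimes> v)) =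
          (t \<otimes> c \<otimes> u \<otimes> x \<otimes> v) \<oplus> (x \<otimes> x) \<otimes> (t \<otimes> (a \<otimes> v))"
        using w yz by (simp add: m_ac l_distr r_distr)
      also have "\<dots> = t \<otimes> ((c \<otimes> v \<oplus> b \<otimes> x) \<otimes> (x \<otimes> u))"
        unfolding t using w yz by (simp add: m_ac l_distr r_distr)
      finally show ?thesis
        using w yz by simp (rule frac_eqI[of t], simp_all)
    qed
  qed
  from UN_equiv_class2[OF equiv_loc_rel equiv_loc_rel this, of "(a, u)" "(b, v)"]
  show ?thesis using assms by (simp add: localization_def loc_frac_def)
qed

lemma one_localization: "\<one>\<^bsub>localization R S\<^esub> = loc_frac R S \<one> \<one>"
  and zero_localization: "\<zero>\<^bsub>localization R S\<^esub> = loc_frac R S \<zero> \<one>"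
  by (simp_all add: localization_def)

text \<open>
  The relation defining $I$ is written with the finite sums and products of the localization.
  These can be pulled through a homomorphism only because its operations are commutative and
  associative, so the ring laws are established first.
\<close>

lemma cring_localization: "cring (localization R S)"
proof (rule cringI)
  show "abelian_group (localization R S)"
  proof (rule abelian_groupI)
    fix A B C
    assume A: "A \<in> carrier (localization R S)" and B: "B \<in> carrier (localization R S)"
    obtain a u b v where ab: "A = loc_frac R S a u" "B = loc_frac R S b v"
      "a \<in> carrier R" "u \<in> S" "b \<in> carrier R" "v \<in> S"
      using A B by (auto elim!: frac_cases)
    show "A \<oplus>\<^bsub>localization R S\<^esub> B \<in> carrier (localization R S)"
      using ab by (simp add: add_frac)
    show "A \<oplus>\<^bsub>localization R S\<^esub> B = B \<oplus>\<^bsub>localization R S\<^esub> A"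
      using ab by (simp add: add_frac m_comm a_comm)
    show "\<zero>\<^bsub>localization R S\<^esub> \<oplus>\<^bsub>localization R S\<^esub> A = A"
      using ab by (simp add: add_frac zero_localization)
    have "loc_frac R S (\<ominus> a) u \<oplus>\<^bsub>localization R S\<^esub> A = loc_frac R S \<zero> \<one>"
      using ab by (simp add: add_frac) (rule frac_eqI', auto simp: l_minus l_neg)
    then show "\<exists>A'\<in>carrier (localization R S).
        A' \<oplus>\<^bsub>localization R S\<^esub> A = \<zero>\<^bsub>localization R S\<^esub>"
      using ab by (intro bexI[of _ "loc_frac R S (\<ominus> a) u"]) (simp_all add: zero_localization)
    assume C: "C \<in> carrier (localization R S)"
    then obtain c w where c: "C = loc_frac R S c w" "c \<in> carrier R" "w \<in> S"
      by (rule frac_cases)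
    show "A \<oplus>\<^bsub>localization R S\<^esub> B \<oplus>\<^bsub>localization R S\<^esub> C =
        A \<oplus>\<^bsub>localization R S\<^esub> (B \<oplus>\<^bsub>localization R S\<^esub> C)"
      using ab c by (simp add: add_frac m_ac l_distr r_distr a_ac)
  qed (simp add: zero_localization)
  show "comm_monoid (localization R S)"
  proof (rule comm_monoidI)
    fix A B C
    assume A: "A \<in> carrier (localization R S)" and B: "B \<in> carrier (localization R S)"
    obtain a u b v where ab: "A = loc_frac R S a u" "B = loc_frac R S b v"
      "a \<in> carrier R" "u \<in> S" "b \<in> carrier R" "v \<in> S"
      using A B by (auto elim!: frac_cases)
    show "A \<otimes>\<^bsub>localization R S\<^esub> B \<in> carrier (localization R S)"
      using ab by (simp add: mult_frac)
    show "A \<otimes>\<^bsub>localization R S\<^esub> B = B \<otimes>\<^bsub>localization R S\<^esub> A"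
      using ab by (simp add: mult_frac m_comm)
    show "\<one>\<^bsub>localization R S\<^esub> \<otimes>\<^bsub>localization R S\<^esub> A = A"
      using ab by (simp add: mult_frac one_localization)
    assume C: "C \<in> carrier (localization R S)"
    then obtain c w where c: "C = loc_frac R S c w" "c \<in> carrier R" "w \<in> S"
      by (rule frac_cases)
    show "A \<otimes>\<^bsub>localization R S\<^esub> B \<otimes>\<^bsub>localization R S\<^esub> C =
        A \<otimes>\<^bsub>localization R S\<^esub> (B \<otimes>\<^bsub>localization R S\<^esub> C)"
      using ab c by (simp add: mult_frac m_assoc)
  qed (simp add: one_localization)
  fix A B C
  assume "A \<in> carrier (localization R S)" "B \<in> carrier (localization R S)"
    "C \<in> carrier (localization R S)"
  then obtain a u b v c w where abc:
      "A = loc_frac R S a u" "B = loc_frac R S b v" "C = loc_frac R S c w"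
      "a \<in> carrier R" "u \<in> S" "b \<in> carrier R" "v \<in> S" "c \<in> carrier R" "w \<in> S"
    by (metis frac_cases)
  show "(A \<oplus>\<^bsub>localization R S\<^esub> B) \<otimes>\<^bsub>localization R S\<^esub> C =
      A \<otimes>\<^bsub>localization R S\<^esub> C \<oplus>\<^bsub>localization R S\<^esub> B \<otimes>\<^bsub>localization R S\<^esub> C"
    using abc by (simp add: mult_frac add_frac)
      (rule frac_eqI', auto simp: m_ac l_distr r_distr)
qed

lemma frac_Units:
  assumes "u \<in> S"
  shows "loc_frac R S u \<one> \<in> Units (localization R S)"
proof -
  interpret L: cring "localization R S" by (rule cring_localization)
  have closed: "loc_frac R S u \<one> \<in> carrier (localization R S)"
      "loc_frac R S \<one> u \<in> carrier (localization R S)"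
    using assms by simp_all
  moreover have "loc_frac R S \<one> u \<otimes>\<^bsub>localization R S\<^esub> loc_frac R S u \<one> = \<one>\<^bsub>localization R S\<^esub>"
    using assms frac_eqI'[of u \<one> \<one> u] by (simp add: mult_frac one_localization)
  ultimately show ?thesis
    unfolding Units_def using L.m_comm[OF closed] by blast
qed

text \<open>
  The fraction is represented by an arbitrary pair. The value is independent of this choice
  when \<open>\<phi>\<close> is a ring homomorphism without zeros on \<open>S\<close>.
\<close>

definition localization_lift :: "('a \<Rightarrow> 'c::field) \<Rightarrow> ('a \<times> 'a) set \<Rightarrow> 'c" where
  "localization_lift \<phi> A = (case SOME p. p \<in> A of (a, u) \<Rightarrow> \<phi> a / \<phi> u)"

context
  fixes \<phi> :: "'a \<Rightarrow> 'c::field"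
  assumes hom: "field_valued_hom R \<phi>"
    and nonzero: "\<And>u. u \<in> S \<Longrightarrow> \<phi> u \<noteq> 0"
begin

interpretation \<phi>: field_valued_hom R \<phi>
  by (rule hom)

lemma localization_lift_frac:
  assumes "a \<in> carrier R" "u \<in> S"
  shows "localization_lift \<phi> (loc_frac R S a u) = \<phi> a / \<phi> u"
proof -
  let ?p = "SOME p. p \<in> loc_frac R S a u"
  have "(a, u) \<in> loc_frac R S a u"
    using assms equiv_class_self[OF equiv_loc_rel] by (simp add: loc_frac_def)
  then have "?p \<in> loc_frac R S a u"
    by (rule someI)
  then obtain b v t where p: "?p = (b, v)" and bv: "b \<in> carrier R" "v \<in> S" "t \<in> S"
    and t: "t \<otimes> (a \<otimes> v) = t \<otimes> (b \<otimes> u)"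
    by (auto simp: loc_frac_def loc_rel_def)
  have "\<phi> t * (\<phi> a * \<phi> v) = \<phi> t * (\<phi> b * \<phi> u)"
    using arg_cong[OF t, of \<phi>] assms bv by simp
  then have "\<phi> b / \<phi> v = \<phi> a / \<phi> u"
    using assms bv by (simp add: nonzero field_simps)
  then show ?thesis
    by (simp add: localization_lift_def p)
qed

lemma field_valued_hom_localization_lift:
  "field_valued_hom (localization R S) (localization_lift \<phi>)"
proof (intro field_valued_hom.intro field_valued_hom_axioms.intro cring_localization ring_hom_memI)
  fix A B
  assume "A \<in> carrier (localization R S)" "B \<in> carrier (localization R S)"
  then obtain a u b v where ab: "A = loc_frac R S a u" "B = loc_frac R S b v"
      "a \<in> carrier R" "u \<in> S" "b \<in> carrier R" "v \<in> S"
    by (auto elim!: frac_cases)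
  show "localization_lift \<phi> (A \<otimes>\<^bsub>localization R S\<^esub> B) =
      localization_lift \<phi> A \<otimes>\<^bsub>ring_of_type_algebra\<^esub> localization_lift \<phi> B"
    using ab by (simp add: mult_frac localization_lift_frac ring_of_type_algebra_def)
  show "localization_lift \<phi> (A \<oplus>\<^bsub>localization R S\<^esub> B) =
      localization_lift \<phi> A \<oplus>\<^bsub>ring_of_type_algebra\<^esub> localization_lift \<phi> B"
    using ab by (simp add: add_frac localization_lift_frac ring_of_type_algebra_def
        nonzero add_frac_eq)
qed (simp_all add: one_localization localization_lift_frac ring_of_type_algebra_def)

end

end

lemma submonoid_mult_generated:
  assumes "monoid R" "H \<subseteq> carrier R"
  shows "submonoid (mult_generated R H) R"
proof
  interpret monoid R by fact
  show "mult_generated R H \<subseteq> carrier R"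
  proof
    fix h assume "h \<in> mult_generated R H"
    then show "h \<in> carrier R"
      by induction (use assms in auto)
  qed
qed (auto intro: mult_generated.intros)

section \<open>Relations among the generators\<close>

lemma const_in_coord_ring:
  "generating_family K n V J f \<Longrightarrow> c \<in> K \<Longrightarrow> const_on V c \<in> carrier (coord_ring K n V)"
  unfolding generating_family_def by (blast intro: generate_ring.incl)

text \<open>
  The subring generated by the constants and the $f_j$ is closed under both operations, and by
  hypothesis it is the whole carrier. This replaces the arithmetic of polynomials in several
  variables.
\<close>

lemma coord_ring_closed:
  assumes "generating_family K n V J f" "g \<in> carrier (coord_ring K n V)" "h \<in> carrier (coord_ring K n V)"
  shows "(\<lambda>x\<in>V. g x * h x) \<in> carrier (coord_ring K n V)"
    and "(\<lambda>x\<in>V. g x + h x) \<in> carrier (coord_ring K n V)"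
proof -
  have *: "generate_ring (coord_ring K n V) (const_on V ` K \<union> f ` J) = carrier (coord_ring K n V)"
    using assms(1) by (simp add: generating_family_def)
  show "(\<lambda>x\<in>V. g x * h x) \<in> carrier (coord_ring K n V)"
    using generate_ring.eng_mult[of g "coord_ring K n V" _ h] assms unfolding *[symmetric]
    by (simp add: coord_ring_def)
  show "(\<lambda>x\<in>V. g x + h x) \<in> carrier (coord_ring K n V)"
    using generate_ring.eng_add[of g "coord_ring K n V" _ h] assms unfolding *[symmetric]
    by (simp add: coord_ring_def)
qed

lemma coord_ring_extensional: "g \<in> carrier (coord_ring K n V) \<Longrightarrow> g \<in> extensional V"
  by (auto simp: coord_ring_def)

lemma subfield_consts:
  assumes "subfield K (ring_of_type_algebra :: real ring)"
  shows "0 \<in> K" "1 \<in> K" "-1 \<in> K"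
proof -
  interpret field "ring_of_type_algebra :: real ring" by (rule field_from_type_algebra)
  interpret subfield K "ring_of_type_algebra :: real ring" by fact
  have sr: "subring K (ring_of_type_algebra :: real ring)" by (rule subring_axioms)
  show "0 \<in> K" "1 \<in> K"
    using subringE(2,3)[OF sr] by (simp_all add: ring_of_type_algebra_def)
  have "\<ominus>\<^bsub>ring_of_type_algebra\<^esub> (1::real) = -1"
    by (rule minus_equality) (auto simp: ring_of_type_algebra_def)
  then show "-1 \<in> K"
    using subringE(5)[OF sr \<open>1 \<in> K\<close>] by simp
qed

lemma coord_ring_cring:
  assumes K: "subfield K (ring_of_type_algebra :: real ring)" and gen: "generating_family K n V J f"
  shows "cring (coord_ring K n V)"
proof -
  note const = const_in_coord_ring[OF gen] and closed = coord_ring_closed[OF gen]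
  note ext = coord_ring_extensional[of _ K n V]
  have ops: "mult (coord_ring K n V) = (\<lambda>g h. \<lambda>x\<in>V. g x * h x)"
    "add (coord_ring K n V) = (\<lambda>g h. \<lambda>x\<in>V. g x + h x)"
    "\<one>\<^bsub>coord_ring K n V\<^esub> = const_on V 1" "\<zero>\<^bsub>coord_ring K n V\<^esub> = const_on V 0"
    by (simp_all add: coord_ring_def)
  show ?thesis
  proof (rule cringI)
    show "abelian_group (coord_ring K n V)"
    proof (rule abelian_groupI, unfold ops)
      show "const_on V 0 \<in> carrier (coord_ring K n V)"
        using const subfield_consts[OF K] by simp
      fix g assume g: "g \<in> carrier (coord_ring K n V)"
      then show "(\<lambda>x\<in>V. const_on V 0 x + g x) = g"
        using ext[of g] by (auto simp: const_on_def fun_eq_iff extensional_def)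
      show "\<exists>h\<in>carrier (coord_ring K n V). (\<lambda>x\<in>V. h x + g x) = const_on V 0"
        by (rule bexI[OF _ closed(1)[OF const[of "-1"] g]])
          (use subfield_consts[OF K] in \<open>auto simp: const_on_def\<close>)
    qed (auto simp: closed fun_eq_iff)
    show "comm_monoid (coord_ring K n V)"
    proof (rule comm_monoidI, unfold ops)
      show "const_on V 1 \<in> carrier (coord_ring K n V)"
        using const subfield_consts[OF K] by simp
      fix g assume g: "g \<in> carrier (coord_ring K n V)"
      then show "(\<lambda>x\<in>V. const_on V 1 x * g x) = g"
        using ext[of g] by (auto simp: const_on_def fun_eq_iff extensional_def)
    qed (auto simp: closed fun_eq_iff)
  qed (auto simp: ops fun_eq_iff algebra_simps)
qed

lemma eval_ring_hom:
  assumes "x \<in> V"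
  shows "(\<lambda>g. g x) \<in> ring_hom (coord_ring K n V) (ring_of_type_algebra :: real ring)"
  using assms by (auto simp: ring_hom_def coord_ring_def ring_of_type_algebra_def const_on_def)

text \<open>
  At a point of \<open>V'\<close> evaluation has no zero on the multiplicative set generated by the
  $f_j$. It therefore lifts to $k[V']$ and sends the image of a Laurent polynomial to its value
  at $(f_j(x))_j$, which is $0$ when that image is.
\<close>

lemma relation_vanishes:
  assumes K: "subfield K (ring_of_type_algebra :: real ring)" and gen: "generating_family K n V J f"
    and a: "a \<in> relation_ideal K n V J f" and x: "x \<in> nonvanishing_locus V J f"
  shows "(\<Sum>\<omega>\<in>Poly_Mapping.keys a. Poly_Mapping.lookup a \<omega> *
    (\<Prod>j\<in>Poly_Mapping.keys \<omega>. f j x powi Poly_Mapping.lookup \<omega> j)) = 0"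
proof -
  define R where "R = coord_ring K n V"
  define S where "S = mult_generated R (f ` J)"
  define \<phi> :: "((nat \<Rightarrow> real) \<Rightarrow> real) \<Rightarrow> real" where "\<phi> = (\<lambda>g. g x)"
  interpret R: cring R unfolding R_def by (rule coord_ring_cring[OF K gen])
  have fJ: "f j \<in> carrier R" if "j \<in> J" for j
    using gen that by (auto simp: generating_family_def R_def)
  have "submonoid S R"
    unfolding S_def using fJ by (intro submonoid_mult_generated R.monoid_axioms) auto
  then interpret localizable S R
    by (intro localizable.intro R.cring_axioms)
  have xV: "x \<in> V" and fx: "\<And>j. j \<in> J \<Longrightarrow> f j x \<noteq> 0"
    using x by (auto simp: nonvanishing_locus_def)
  have "\<phi> \<in> ring_hom R ring_of_type_algebra"
    unfolding R_def \<phi>_def by (rule eval_ring_hom[OF xV])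
  then have hom: "field_valued_hom R \<phi>"
    by (intro field_valued_hom.intro field_valued_hom_axioms.intro R.cring_axioms)
  interpret \<phi>: field_valued_hom R \<phi> by (rule hom)
  have nonzero: "\<phi> u \<noteq> 0" if "u \<in> S" for u
    using that unfolding S_def
  proof induction
    case (mult g h)
    then show ?case by (metis S_carrier S_def \<phi>.hom_simps(1) mult_eq_0_iff)
  qed (use fx in \<open>auto simp: \<phi>_def[abs_def] R_def coord_ring_def const_on_def xV\<close>)
  interpret L: field_valued_hom "localization R S" "localization_lift \<phi>"
    by (rule field_valued_hom_localization_lift[OF hom nonzero])
  have lift: "localization_lift \<phi> (loc_frac R S g \<one>\<^bsub>R\<^esub>) = g x" if "g \<in> carrier R" for g
    using localization_lift_frac[OF hom nonzero that, of "\<one>\<^bsub>R\<^esub>"] by (simp add: \<phi>_def[symmetric])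
      (simp add: \<phi>_def)
  have aK: "Poly_Mapping.lookup a \<omega> \<in> K" "Poly_Mapping.keys \<omega> \<subseteq> J" 
    if "\<omega> \<in> Poly_Mapping.keys a" for \<omega>
    using a that by (auto simp: relation_ideal_def laurent_polys_def)
  have const: "const_on V (Poly_Mapping.lookup a \<omega>) \<in> carrier R" if "\<omega> \<in> Poly_Mapping.keys a" for \<omega>
    unfolding R_def by (rule const_in_coord_ring[OF gen aK(1)[OF that]])
  have unit: "loc_frac R S (f j) \<one>\<^bsub>R\<^esub> \<in> Units (localization R S)" if "j \<in> J" for j
    using that by (intro frac_Units) (auto simp: S_def intro: mult_generated.incl)
  have pow: "loc_frac R S (f j) \<one>\<^bsub>R\<^esub> [^]\<^bsub>localization R S\<^esub> z \<in> carrier (localization R S)"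
    if "j \<in> J" for j and z :: int
    using unit[OF that] by (simp add: int_pow_def2 L.Units_pow_closed L.Units_closed L.Units_inv_closed del: pow_nat)
  have monomial: "(\<Otimes>\<^bsub>localization R S\<^esub>j\<in>Poly_Mapping.keys \<omega>. loc_frac R S (f j) \<one>\<^bsub>R\<^esub>
      [^]\<^bsub>localization R S\<^esub> Poly_Mapping.lookup \<omega> j) \<in> carrier (localization R S)"
    if "\<omega> \<in> Poly_Mapping.keys a" for \<omega>
    by (rule L.finprod_closed, rule Pi_I, rule pow) (use aK(2)[OF that] in blast)
  have "0 = localization_lift \<phi> (laurent_hom K n V J f a)"
    using a by (simp add: relation_ideal_def coord_ring_loc_def R_def[symmetric] S_def[symmetric])
  also have "\<dots> = (\<Sum>\<omega>\<in>Poly_Mapping.keys a. localization_lift \<phi> (loc_frac R S (const_on V (Poly_Mapping.lookup a \<omega>)) \<one>\<^bsub>R\<^esub>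
      \<otimes>\<^bsub>localization R S\<^esub> (\<Otimes>\<^bsub>localization R S\<^esub>j\<in>Poly_Mapping.keys \<omega>.
        loc_frac R S (f j) \<one>\<^bsub>R\<^esub> [^]\<^bsub>localization R S\<^esub> Poly_Mapping.lookup \<omega> j)))"
    unfolding laurent_hom_def Let_def coord_ring_loc_def to_coord_ring_loc_def
      R_def[symmetric] S_def[symmetric]
    by (rule L.hom_finsum, simp, rule Pi_I, rule L.m_closed[OF frac_closed[OF const] monomial]) simp_all
  also have "\<dots> = (\<Sum>\<omega>\<in>Poly_Mapping.keys a. Poly_Mapping.lookup a \<omega> *
    (\<Prod>j\<in>Poly_Mapping.keys \<omega>. f j x powi Poly_Mapping.lookup \<omega> j))"
  proof (rule sum.cong[OF refl])
    fix \<omega> assume \<omega>: "\<omega> \<in> Poly_Mapping.keys a"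
    have P: "(\<lambda>j. loc_frac R S (f j) \<one>\<^bsub>R\<^esub> [^]\<^bsub>localization R S\<^esub> Poly_Mapping.lookup \<omega> j)
        \<in> Poly_Mapping.keys \<omega> \<rightarrow> carrier (localization R S)"
      using aK(2)[OF \<omega>] pow by auto
    have "(\<Prod>j\<in>Poly_Mapping.keys \<omega>. localization_lift \<phi>
          (loc_frac R S (f j) \<one>\<^bsub>R\<^esub> [^]\<^bsub>localization R S\<^esub> Poly_Mapping.lookup \<omega> j)) =
        (\<Prod>j\<in>Poly_Mapping.keys \<omega>. f j x powi Poly_Mapping.lookup \<omega> j)"
      using aK(2)[OF \<omega>] by (intro prod.cong) (auto simp: L.hom_int_pow unit lift fJ)
    then show "localization_lift \<phi> (loc_frac R S (const_on V (Poly_Mapping.lookup a \<omega>)) \<one>\<^bsub>R\<^esub>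
        \<otimes>\<^bsub>localization R S\<^esub> (\<Otimes>\<^bsub>localization R S\<^esub>j\<in>Poly_Mapping.keys \<omega>.
        loc_frac R S (f j) \<one>\<^bsub>R\<^esub> [^]\<^bsub>localization R S\<^esub> Poly_Mapping.lookup \<omega> j)) =
      Poly_Mapping.lookup a \<omega> * (\<Prod>j\<in>Poly_Mapping.keys \<omega>. f j x powi Poly_Mapping.lookup \<omega> j)"
      using P const[OF \<omega>] xV
      by (simp add: L.hom_finprod L.finprod_closed lift const_on_def)
  qed
  finally show ?thesis by simp
qed

section \<open>Properness of the logarithm map\<close>


lemma tendsto_coordinate:
  assumes "x \<in> topspace (powertop_real I)" "i \<in> I"
  shows "((\<lambda>y. y i) \<longlongrightarrow> x i) (atin (powertop_real I) x)"
  using continuous_map_product_projection[OF assms(2), of "\<lambda>_. euclideanreal"] assms(1)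
  by (simp add: continuous_map_atin)

lemma continuous_map_mpoly_eval:
  assumes "p \<in> mpolys K n"
  shows "continuous_map (powertop_real {..<n}) euclideanreal (mpoly_eval p)"
  unfolding continuous_map_atin limitin_canonical_iff
proof
  fix x assume x: "x \<in> topspace (powertop_real {..<n})"
  show "(mpoly_eval p \<longlongrightarrow> mpoly_eval p x) (atin (powertop_real {..<n}) x)"
    unfolding mpoly_eval_def[abs_def]
  proof (intro tendsto_sum tendsto_mult tendsto_const tendsto_prod tendsto_power)
    fix m i assume "m \<in> Poly_Mapping.keys p" "i \<in> Poly_Mapping.keys m"
    then have "i \<in> {..<n}" using assms by (auto simp: mpolys_def)
    then show "((\<lambda>y. y i) \<longlongrightarrow> x i) (atin (powertop_real {..<n}) x)"
      by (rule tendsto_coordinate[OF x])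
  qed
qed

lemma closedin_affine_variety:
  assumes "affine_variety K n V"
  shows "closedin (powertop_real {..<n}) V"
proof -
  obtain P where P: "P \<subseteq> mpolys K n"
    and V: "V = {x \<in> topspace (powertop_real {..<n}). \<forall>p\<in>P. mpoly_eval p x = 0}"
    using assms by (auto simp: affine_variety_def)
  have "V = topspace (powertop_real {..<n}) \<inter>
      (\<Inter>p\<in>P. {x \<in> topspace (powertop_real {..<n}). mpoly_eval p x \<in> {0}})"
    unfolding V by blast
  also have "closedin (powertop_real {..<n}) \<dots>"
  proof (cases "P = {}")
    case False
    then show ?thesis
      using P by (intro closedin_Int closedin_topspace closedin_INT
        closedin_continuous_map_preimage[where Y = euclideanreal] continuous_map_mpoly_eval[of _ K]) auto
  qed (use closedin_topspace[of "powertop_real {..<n}"] in simp)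
  finally show ?thesis .
qed

lemma closedin_preimage_regular_function:
  assumes V: "affine_variety K n V" and g: "g \<in> carrier (coord_ring K n V)" and C: "closed C"
  shows "closedin (powertop_real {..<n}) {x \<in> V. g x \<in> C}"
proof -
  obtain p where p: "p \<in> mpolys K n" "g = restrict (mpoly_eval p) V"
    using g by (auto simp: coord_ring_def)
  have "closedin (powertop_real {..<n}) {x \<in> V. mpoly_eval p x \<in> C}"
    by (rule closedin_continuous_map_preimage_gen[OF continuous_map_mpoly_eval[OF p(1)]
          closedin_affine_variety[OF V]]) (use C in simp)
  also have "{x \<in> V. mpoly_eval p x \<in> C} = {x \<in> V. g x \<in> C}"
    using p(2) by auto
  finally show ?thesis .
qed

lemma coordinate_in_coord_ring:
  assumes "1 \<in> K" "i < n"
  shows "(\<lambda>x\<in>V. x i) \<in> carrier (coord_ring K n V)"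
proof -
  let ?p = "Poly_Mapping.single (Poly_Mapping.single i (1::nat)) (1::real)"
  have "mpoly_eval ?p x = x i" for x
    by (simp add: mpoly_eval_def)
  moreover have "?p \<in> mpolys K n"
    using assms by (simp add: mpolys_def)
  ultimately show ?thesis
    by (auto simp: coord_ring_def intro!: image_eqI[of _ _ ?p])
qed

text \<open>
  Sums, products and negatives of functions bounded on \<open>C\<close> are again bounded, so boundedness
  passes from the generators to the ring that they generate.
\<close>

lemma bounded_if_generators_bounded:
  assumes R: "cring (coord_ring K n V)" and gen: "generating_family K n V J f"
    and C: "C \<subseteq> V" and bdd: "\<And>j. j \<in> J \<Longrightarrow> bounded (f j ` C)"
    and g: "g \<in> carrier (coord_ring K n V)"
  shows "bounded (g ` C)"
proof -
  interpret cring "coord_ring K n V" by fact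
  have gen': "generate_ring (coord_ring K n V) (const_on V ` K \<union> f ` J) = carrier (coord_ring K n V)"
    using gen by (simp add: generating_family_def)
  have "g \<in> generate_ring (coord_ring K n V) (const_on V ` K \<union> f ` J)"
    using g gen' by simp
  then show ?thesis
  proof induction
    case one
    have "\<one>\<^bsub>coord_ring K n V\<^esub> ` C \<subseteq> {1}"
      using C by (auto simp: coord_ring_def const_on_def)
    then show ?case by (rule bounded_subset[rotated]) simp
  next
    case (incl h)
    then consider c where "h = const_on V c" | "h \<in> f ` J" by auto
    then show ?case
    proof cases
      case 1
      then have "h ` C \<subseteq> {c}"
        using C by (auto simp: const_on_def)
      then show ?thesis by (rule bounded_subset[rotated]) simp
    qed (use bdd in auto)
  next
    case (a_inv h)
    have "h \<oplus>\<^bsub>coord_ring K n V\<^esub> \<ominus>\<^bsub>coord_ring K n V\<^esub> h = \<zero>\<^bsub>coord_ring K n V\<^esub>"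
      using a_inv.hyps gen' r_neg by blast
    then have *: "h x + (\<ominus>\<^bsub>coord_ring K n V\<^esub> h) x = 0" if "x \<in> V" for x
      using that by (auto simp: coord_ring_def const_on_def dest: fun_cong[of _ _ x])
    then have "(\<ominus>\<^bsub>coord_ring K n V\<^esub> h) x = - h x" if "x \<in> V" for x
      using that by (metis add_eq_0_iff)
    then have "(\<ominus>\<^bsub>coord_ring K n V\<^esub> h) ` C = uminus ` h ` C"
      using C by (force simp: image_image intro!: image_cong)
    then show ?case
      using a_inv.IH by simp
  next
    case (eng_add g h)
    have "(g \<oplus>\<^bsub>coord_ring K n V\<^esub> h) ` C = (\<lambda>x. g x + h x) ` C"
      using C by (intro image_cong) (auto simp: coord_ring_def)
    then show ?case
      using bounded_plus_comp[of g C h] eng_add.IH by simp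
  next
    case (eng_mult g h)
    have "(g \<otimes>\<^bsub>coord_ring K n V\<^esub> h) ` C = (\<lambda>x. g x * h x) ` C"
      using C by (intro image_cong) (auto simp: coord_ring_def)
    moreover obtain a b where "\<forall>x\<in>C. \<bar>g x\<bar> \<le> a" "\<forall>x\<in>C. \<bar>h x\<bar> \<le> b"
      using eng_mult.IH by (auto simp: bounded_iff)
    then have "\<forall>x\<in>C. norm (g x * h x) \<le> a * b"
      by (auto simp: abs_mult intro!: mult_mono') 
    then have "bounded ((\<lambda>x. g x * h x) ` C)"
      by (auto simp: bounded_iff)
    ultimately show ?case by simp
  qed
qed

text \<open>
  A bound on $|\log|f_j||$ confines $|f_j|$ to a compact interval of positive numbers. The set in
  question is thus closed in the ambient affine space, even though \<open>V'\<close> need not be, and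
  since all $f_j$ are bounded on it, the coordinate functions are as well. So it is a closed subset
  of a compact box. For infinite \<open>J\<close> the bounds \<open>M j\<close> may be unbounded in \<open>j\<close>.
\<close>

lemma Log_map_proper:
  assumes K: "1 \<in> K" "cring (coord_ring K n V)"
    and V: "affine_variety K n V" and gen: "generating_family K n V J f"
  shows "compactin (subtopology (powertop_real {..<n}) (nonvanishing_locus V J f))
    {x \<in> nonvanishing_locus V J f. \<forall>j\<in>J. \<bar>Log_map J f x j\<bar> \<le> M j}"
proof -
  let ?X = "powertop_real {..<n}"
  let ?C = "{x \<in> nonvanishing_locus V J f. \<forall>j\<in>J. \<bar>Log_map J f x j\<bar> \<le> M j}"
  have fJ: "f j \<in> carrier (coord_ring K n V)" if "j \<in> J" for j
    using gen that by (auto simp: generating_family_def)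
  have CV: "?C \<subseteq> V"
    by (auto simp: nonvanishing_locus_def)
  have box: "y \<noteq> 0 \<and> \<bar>ln \<bar>y\<bar>\<bar> \<le> m \<longleftrightarrow> \<bar>y\<bar> \<in> {exp (- m)..exp m}" for y m :: real
  proof (cases "y = 0")
    case False
    then have "exp (ln \<bar>y\<bar>) = \<bar>y\<bar>" by simp
    then show ?thesis
      using False by (smt (verit) atLeastAtMost_iff exp_le_cancel_iff)
  qed simp
  have "?C = V \<inter> (\<Inter>j\<in>J. {x \<in> V. f j x \<in> abs -` {exp (- M j)..exp (M j)}})"
    by (auto simp: nonvanishing_locus_def Log_map_def box[symmetric] simp del: atLeastAtMost_iff)
  also have "closedin ?X \<dots>"
  proof (cases "J = {}")
    case False
    have "closed (abs -` {exp (- M j)..exp (M j)})" for j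
      by (intro continuous_closed_vimage) (auto intro!: continuous_intros)
    then show ?thesis
      using False fJ by (intro closedin_Int closedin_affine_variety[OF V] closedin_INT
          closedin_preimage_regular_function[OF V]) auto
  qed (use closedin_affine_variety[OF V] in simp)
  finally have closed: "closedin ?X ?C" .
  have "bounded (f j ` ?C)" if "j \<in> J" for j
    unfolding bounded_iff using that box
    by (intro exI[of _ "exp (M j)"]) (auto simp: nonvanishing_locus_def Log_map_def)
  then have "bounded ((\<lambda>x\<in>V. x i) ` ?C)" if "i < n" for i
    using bounded_if_generators_bounded[OF K(2) gen CV] coordinate_in_coord_ring[OF K(1) that]
    by blast
  moreover have restrict: "(\<lambda>x\<in>V. x i) ` ?C = (\<lambda>x. x i) ` ?C" for i
    using CV by (intro image_cong) auto
  ultimately have "bounded ((\<lambda>x. x i) ` ?C)" if "i < n" for i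
    using that unfolding restrict by blast
  then have "\<forall>i. \<exists>b. i < n \<longrightarrow> (\<forall>y\<in>(\<lambda>x. x i) ` ?C. \<bar>y\<bar> \<le> b)"
    unfolding bounded_iff real_norm_def by blast
  from choice[OF this] obtain B
    where B: "\<And>i. i < n \<Longrightarrow> \<forall>y\<in>(\<lambda>x. x i) ` ?C. \<bar>y\<bar> \<le> B i"
    by blast
  have ext: "?C \<subseteq> extensional {..<n}"
    using closedin_subset[OF closed] by (auto simp: PiE_def)
  have "?C \<subseteq> (\<Pi>\<^sub>E i\<in>{..<n}. {- B i..B i})"
  proof
    fix x assume x: "x \<in> ?C"
    then have "\<bar>x i\<bar> \<le> B i" if "i < n" for i
      using B[OF that] by blast
    moreover have "x \<in> extensional {..<n}"
      using ext x by blast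
    ultimately show "x \<in> (\<Pi>\<^sub>E i\<in>{..<n}. {- B i..B i})"
      by (force simp: PiE_iff abs_le_iff)
  qed
  moreover have "compactin ?X (\<Pi>\<^sub>E i\<in>{..<n}. {- B i..B i})"
    by (simp add: compactin_PiE)
  ultimately have "compactin ?X ?C"
    using closed by (blast intro: closed_compactin)
  then show ?thesis
    by (auto simp: compactin_subtopology)
qed

section \<open>Points of the cone as limits of rescaled logarithms\<close>

text \<open>
  Convergence of rays is turned into convergence of vectors by the normalization that replaces $w$
  by its positive multiple whose coordinate at $j_0$ has absolute value $|v_{j_0}|$. The
  conditions \<open>w j0 \<noteq> 0\<close> and \<open>q w \<in> W\<close> are invariant under positive
  scaling, so they describe a union of rays that is open in the punctured space, that is, an open set
  of directions.
\<close>

lemma tendsto_of_direction_limit: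
  fixes r :: "nat \<Rightarrow> 'j \<Rightarrow> real"
  assumes lim: "limitin (direction_space J) (\<lambda>i. ray J (r i)) (ray J v) sequentially"
    and r: "\<And>i. r i \<in> extensional J" and v: "v \<in> topspace (punctured_space J)"
    and j0: "j0 \<in> J" "v j0 \<noteq> 0" and j: "j \<in> J"
  shows "\<forall>\<^sub>F i in sequentially. r i j0 \<noteq> 0"
    and "(\<lambda>i. r i j / (\<bar>r i j0\<bar> / \<bar>v j0\<bar>)) \<longlonglongrightarrow> v j"
proof -
  let ?P = "punctured_space J"
  define q where "q w = w j / (\<bar>w j0\<bar> / \<bar>v j0\<bar>)" for w :: "'j \<Rightarrow> real"
  have ray_iff: "w \<in> ray J u \<longleftrightarrow> (\<exists>c>0. w = (\<lambda>j\<in>J. c * u j))" for w u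
    by (simp add: ray_def)
  have self: "r i \<in> ray J (r i)" for i
    unfolding ray_iff by (rule exI[of _ 1]) (use r in \<open>auto simp: fun_eq_iff extensional_def\<close>)
  have ev: "\<forall>\<^sub>F i in sequentially. r i j0 \<noteq> 0 \<and> q (r i) \<in> W" if W: "open W" "q v \<in> W" for W
  proof -
    let ?U = "{w \<in> topspace ?P. w j0 \<noteq> 0 \<and> q w \<in> W}"
    have coord: "((\<lambda>y. y k) \<longlongrightarrow> w k) (atin ?P w)" if "k \<in> J" "w \<in> topspace ?P" for k w
      using continuous_map_from_subtopology[OF continuous_map_product_projection[OF that(1),
            of "\<lambda>_. euclideanreal"], of "topspace (powertop_real J) - {origin J}"] that(2)
      by (simp add: continuous_map_atin punctured_space_def)
    have U: "openin ?P ?U"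
    proof -
      let ?g = "\<lambda>p::real \<times> real. snd p / (\<bar>fst p\<bar> / \<bar>v j0\<bar>)"
      let ?D = "{p::real \<times> real. fst p \<noteq> 0}"
      have "open ?D"
        by (intro open_Collect_neq continuous_intros)
      moreover have "continuous_on ?D ?g"
        using j0(2) by (intro continuous_intros) auto
      ultimately have "open (?D \<inter> ?g -` W)"
        using W(1) by (blast intro: continuous_open_preimage)
      moreover have "continuous_map ?P euclidean (\<lambda>w. (w j0, w j))"
        using coord[OF j0(1)] coord[OF j] by (auto simp: continuous_map_atin intro!: tendsto_Pair)
      ultimately have "openin ?P {w \<in> topspace ?P. (w j0, w j) \<in> ?D \<inter> ?g -` W}"
        by (intro openin_continuous_map_preimage[where Y = euclidean]) auto
      then show ?thesis
        by (simp add: q_def)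
    qed
    have scale: "w \<in> ?U" if wu: "w \<in> topspace ?P" "u \<in> ?U" "ray J w = ray J u" for w u
    proof -
      have "w \<in> ray J w"
        unfolding ray_iff by (rule exI[of _ 1])
          (use wu(1) in \<open>auto simp: fun_eq_iff punctured_space_def PiE_def extensional_def\<close>)
      then obtain c where "c > 0" "w = (\<lambda>j\<in>J. c * u j)"
        using wu(3) by (auto simp: ray_iff)
      then show ?thesis
        using wu j j0 by (auto simp: q_def abs_mult)
    qed
    have "openin (direction_space J) (ray J ` ?U)"
      unfolding direction_space_def openin_quotient_topology
    proof
      have "{w \<in> topspace ?P. ray J w \<in> ray J ` ?U} = ?U"
        using scale by blast
      then show "openin ?P {w \<in> topspace ?P. ray J w \<in> ray J ` ?U}"
        using U by simp
    qed blast
    moreover have "ray J v \<in> ray J ` ?U"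
      using v j0 W by blast
    ultimately have "\<forall>\<^sub>F i in sequentially. ray J (r i) \<in> ray J ` ?U"
      by (rule limitinD[OF lim])
    then show ?thesis
    proof eventually_elim
      case (elim i)
      then obtain u where u: "u \<in> ?U" "ray J (r i) = ray J u" by blast
      then obtain c where "c > 0" "r i = (\<lambda>j\<in>J. c * u j)"
        using self[of i] by (auto simp: ray_iff)
      then show ?case
        using u(1) j j0 by (auto simp: q_def abs_mult)
    qed
  qed
  show "\<forall>\<^sub>F i in sequentially. r i j0 \<noteq> 0"
    using ev[of UNIV] by (auto elim: eventually_mono)
  have "q v = v j"
    using j0 by (simp add: q_def)
  moreover have "(\<lambda>i. q (r i)) \<longlonglongrightarrow> q v"
    by (rule topological_tendstoI) (rule eventually_mono[OF ev], auto)
  ultimately show "(\<lambda>i. r i j / (\<bar>r i j0\<bar> / \<bar>v j0\<bar>)) \<longlonglongrightarrow> v j"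
    by (simp add: q_def)
qed

text \<open>
  For the origin any scales that tend to infinity serve, since dividing one fixed logarithm by
  them gives the limit $0$.
  For a boundary direction the scales come from a coordinate of the logarithms, and they tend to
  infinity because $\mathrm{Log}$ is proper. Treating both alike avoids a separate argument at the
  origin, where the claim is that $A^+$ and $A^-$ are both empty or both nonempty.
\<close>

lemma sign_cone_asymptotic:
  assumes K: "1 \<in> K" "cring (coord_ring K n V)"
    and V: "affine_variety K n V" and gen: "generating_family K n V J f"
    and v: "v \<in> sign_cone n V J f s"
  obtains x t where "\<And>i. x i \<in> sign_locus V J f s" "filterlim t at_top sequentially"
    "\<And>j. j \<in> J \<Longrightarrow> (\<lambda>i. Log_map J f (x i) j / t i) \<longlonglongrightarrow> v j"
proof (cases "v = origin J")
  case True
  from v have "sign_locus V J f s \<noteq> {}"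
    by (auto simp: sign_cone_def split: if_splits)
  then obtain y where y: "y \<in> sign_locus V J f s" by blast
  show ?thesis
  proof (rule that[of "\<lambda>_. y" real])
    show "filterlim real at_top sequentially" by (rule filterlim_real_sequentially)
    show "(\<lambda>i. Log_map J f y j / real i) \<longlonglongrightarrow> v j" if "j \<in> J" for j
      using lim_const_over_n[of "Log_map J f y j"] that by (simp add: True origin_def)
  qed (rule y)
next
  case False
  then have vP: "v \<in> topspace (punctured_space J)" and b: "ray J v \<in> sign_boundary n V J f s"
    using v by (auto simp: sign_cone_def split: if_splits)
  obtain x where x: "\<And>i. x i \<in> sign_locus V J f s"
    and leave: "\<And>C. compactin (subtopology (powertop_real {..<n}) (nonvanishing_locus V J f)) C \<Longrightarrow>
        \<forall>\<^sub>F i in sequentially. x i \<notin> C"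
    and lim: "limitin (direction_space J) (\<lambda>i. ray J (Log_map J f (x i))) (ray J v) sequentially"
    using b by (auto simp: sign_boundary_def)
  have "v \<in> extensional J"
    using vP by (simp add: punctured_space_def PiE_def)
  then obtain j0 where j0: "j0 \<in> J" "v j0 \<noteq> 0"
    using False extensionalityI[of v J "origin J"] by (force simp: origin_def)
  define t where "t i = \<bar>Log_map J f (x i) j0\<bar> / \<bar>v j0\<bar>" for i
  have ext: "Log_map J f (x i) \<in> extensional J" for i
    by (simp add: Log_map_def)
  have conv: "(\<lambda>i. Log_map J f (x i) j / t i) \<longlonglongrightarrow> v j" if "j \<in> J" for j
    unfolding t_def by (rule tendsto_of_direction_limit(2)[OF lim ext vP j0 that])
  have t_pos: "\<forall>\<^sub>F i in sequentially. t i > 0"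
    using tendsto_of_direction_limit(1)[OF lim ext vP j0 j0(1)]
    by eventually_elim (use j0 in \<open>simp add: t_def\<close>)
  have "\<exists>B. \<forall>i. \<bar>Log_map J f (x i) j / t i\<bar> \<le> B" if "j \<in> J" for j
    using convergent_imp_Bseq[OF convergentI[OF conv[OF that]]] by (auto simp: Bseq_def)
  then obtain B where B: "\<bar>Log_map J f (x i) j / t i\<bar> \<le> B j" if "j \<in> J" for i j
    by metis
  have "filterlim t at_top sequentially"
    unfolding filterlim_at_top
  proof
    fix Z
    \<comment> \<open>While the scale stays below \<open>Z\<close>, the bounds \<open>B j\<close> on the rescaled
      logarithms confine \<open>x i\<close> to a compact set, which the sequence eventually leaves.\<close>
    have "\<forall>\<^sub>F i in sequentially. x i \<notin>
        {y \<in> nonvanishing_locus V J f. \<forall>j\<in>J. \<bar>Log_map J f y j\<bar> \<le> B j * Z}"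
      by (rule leave[OF Log_map_proper[OF K V gen]])
    with t_pos show "\<forall>\<^sub>F i in sequentially. Z \<le> t i"
    proof eventually_elim
      case (elim i)
      have "x i \<in> nonvanishing_locus V J f"
        using x[of i] by (auto simp: nonvanishing_locus_def sign_locus_def)
      then obtain j where j: "j \<in> J" "B j * Z < \<bar>Log_map J f (x i) j\<bar>"
        using elim(2) by force
      note j(2)
      also have "\<bar>Log_map J f (x i) j\<bar> \<le> B j * t i"
        using B[OF j(1), of i] elim(1) by (simp add: field_simps)
      finally have "B j * Z < B j * t i" .
      moreover have "0 \<le> B j"
        using order_trans[OF abs_ge_zero B[OF j(1), of i]] .
      ultimately show ?case
        by (metis mult_left_mono linorder_le_cases not_le)
    qed
  qed
  then show ?thesis
    by (rule that[OF x _ conv])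
qed

section \<open>Balanced sums of exponentials\<close>


lemma exp_sum_negligible:
  fixes p :: "'i \<Rightarrow> 'w \<Rightarrow> real"
  assumes t: "filterlim t at_top F"
    and p: "\<And>\<omega>. \<omega> \<in> insert \<omega>0 N \<Longrightarrow> ((\<lambda>i. p i \<omega>) \<longlongrightarrow> q \<omega>) F"
    and q: "\<And>\<omega>. \<omega> \<in> N \<Longrightarrow> q \<omega> < q \<omega>0"
  shows "((\<lambda>i. \<Sum>\<omega>\<in>N. d \<omega> * exp (t i * (p i \<omega> - p i \<omega>0))) \<longlongrightarrow> 0) F"
proof -
  have "((\<lambda>i. d \<omega> * exp (t i * (p i \<omega> - p i \<omega>0))) \<longlongrightarrow> d \<omega> * 0) F" if "\<omega> \<in> N" for \<omega>
  proof (intro tendsto_mult tendsto_const filterlim_compose[OF exp_at_bot])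
    have "((\<lambda>i. p i \<omega> - p i \<omega>0) \<longlongrightarrow> q \<omega> - q \<omega>0) F"
      using that by (intro tendsto_diff p) auto
    from filterlim_tendsto_neg_mult_at_bot[OF this _ t] q[OF that]
    show "filterlim (\<lambda>i. t i * (p i \<omega> - p i \<omega>0)) at_bot F"
      by (simp add: mult.commute)
  qed
  then have "((\<lambda>i. \<Sum>\<omega>\<in>N. d \<omega> * exp (t i * (p i \<omega> - p i \<omega>0))) \<longlongrightarrow> (\<Sum>\<omega>\<in>N. d \<omega> * 0)) F"
    by (rule tendsto_sum)
  then show ?thesis by simp
qed

text \<open>
  If the largest exponent of \<open>P\<close> exceeded every exponent of \<open>N\<close>, division by its
  exponential would bound a positive constant by a quantity that tends to $0$. An empty \<open>N\<close>
  is no exception: the right-hand side is then $0$, and \<open>P\<close> has to be empty too.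
\<close>

lemma max_pairing_le_of_exp_sum_le:
  assumes fin: "finite P" "finite N" and c: "\<And>\<omega>. \<omega> \<in> P \<Longrightarrow> c \<omega> > 0"
    and t: "filterlim t at_top F" and F: "F \<noteq> bot"
    and r: "\<And>\<omega> j. \<omega> \<in> P \<union> N \<Longrightarrow> j \<in> Poly_Mapping.keys \<omega> \<Longrightarrow> ((\<lambda>i. r i j / t i) \<longlongrightarrow> v j) F"
    and le: "\<And>i. (\<Sum>\<omega>\<in>P. c \<omega> * exp (pairing (r i) \<omega>)) \<le> (\<Sum>\<omega>\<in>N. d \<omega> * exp (pairing (r i) \<omega>))"
  shows "max_pairing P v \<le> max_pairing N v"
proof (rule ccontr)
  assume "\<not> max_pairing P v \<le> max_pairing N v"
  then have less: "max_pairing N v < max_pairing P v" by simp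
  then have "P \<noteq> {}" by (auto simp: max_pairing_def)
  then have "Max (pairing v ` P) \<in> pairing v ` P"
    using fin by (intro Max_in) auto
  then obtain \<omega>0 where \<omega>0: "\<omega>0 \<in> P" "pairing v \<omega>0 = Max (pairing v ` P)"
    by force
  have N_less: "pairing v \<omega> < pairing v \<omega>0" if "\<omega> \<in> N" for \<omega>
  proof -
    have "pairing v \<omega> \<le> Max (pairing v ` N)"
      using that fin by simp
    also have "\<dots> < pairing v \<omega>0"
      using less that \<omega>0(2) \<open>P \<noteq> {}\<close> by (auto simp: max_pairing_def split: if_splits)
    finally show ?thesis .
  qed
  define p where "p i \<omega> = pairing (\<lambda>j. r i j / t i) \<omega>" for i and \<omega>
  have p: "((\<lambda>i. p i \<omega>) \<longlongrightarrow> pairing v \<omega>) F" if "\<omega> \<in> insert \<omega>0 N" for \<omega>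
    unfolding p_def pairing_def
    by (intro tendsto_sum tendsto_mult tendsto_const r) (use that \<omega>0 in auto)
  have "\<forall>\<^sub>F i in F. 0 < t i"
    using t by (simp add: filterlim_at_top_dense)
  then have "\<forall>\<^sub>F i in F. c \<omega>0 \<le> (\<Sum>\<omega>\<in>N. d \<omega> * exp (t i * (p i \<omega> - p i \<omega>0)))"
  proof eventually_elim
    case (elim i)
    have scale: "pairing (r i) \<omega> = t i * p i \<omega>" for \<omega>
      using elim by (simp add: pairing_def p_def sum_distrib_left)
    have "c \<omega>0 * exp (pairing (r i) \<omega>0) \<le> (\<Sum>\<omega>\<in>P. c \<omega> * exp (pairing (r i) \<omega>))"
      using \<omega>0 fin c by (intro member_le_sum) (auto simp: less_imp_le)
    also note le
    finally have "c \<omega>0 \<le> (\<Sum>\<omega>\<in>N. d \<omega> * exp (pairing (r i) \<omega>)) / exp (pairing (r i) \<omega>0)"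
      by (simp add: pos_le_divide_eq)
    then show ?case
      by (simp add: sum_divide_distrib scale right_diff_distrib exp_diff)
  qed
  moreover have "((\<lambda>i. \<Sum>\<omega>\<in>N. d \<omega> * exp (t i * (p i \<omega> - p i \<omega>0))) \<longlongrightarrow> 0) F"
    by (rule exp_sum_negligible[where q = "pairing v"]) (fact t p N_less)+
  ultimately have "c \<omega>0 \<le> 0"
    using F by (blast intro: tendsto_lowerbound)
  with c[OF \<omega>0(1)] show False by simp
qed

lemma monomial_eq_sign_times_exp:
  assumes x: "x \<in> sign_locus V J f s" and s: "s \<in> J \<rightarrow> {-1, 1}" and \<omega>: "Poly_Mapping.keys \<omega> \<subseteq> J"
  shows "(\<Prod>j\<in>Poly_Mapping.keys \<omega>. f j x powi Poly_Mapping.lookup \<omega> j) =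
    (\<Prod>j\<in>Poly_Mapping.keys \<omega>. s j powi Poly_Mapping.lookup \<omega> j) * exp (pairing (Log_map J f x) \<omega>)"
proof -
  have "f j x powi m = s j powi m * exp (Log_map J f x j * of_int m)" if "j \<in> J" for j m
  proof -
    have pos: "s j * f j x > 0" and sj: "s j = -1 \<or> s j = 1"
      using x s that by (auto simp: sign_locus_def)
    then have "f j x = s j * exp (Log_map J f x j)"
      using that by (auto simp: Log_map_def)
    then have "f j x powi m = s j powi m * exp (Log_map J f x j) powi m"
      by (simp add: power_int_mult_distrib)
    then show ?thesis
      by (simp add: exp_power_int mult.commute)
  qed
  then have "(\<Prod>j\<in>Poly_Mapping.keys \<omega>. f j x powi Poly_Mapping.lookup \<omega> j) =
    (\<Prod>j\<in>Poly_Mapping.keys \<omega>. s j powi Poly_Mapping.lookup \<omega> j *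
      exp (Log_map J f x j * of_int (Poly_Mapping.lookup \<omega> j)))"
    using \<omega> by (intro prod.cong) auto
  then show ?thesis
    by (simp add: prod.distrib pairing_def exp_sum)
qed

lemma powi_sign_nonzero:
  fixes s :: "'j \<Rightarrow> real"
  assumes "s \<in> J \<rightarrow> {-1, 1}" "Poly_Mapping.keys \<omega> \<subseteq> J"
  shows "(\<Prod>j\<in>Poly_Mapping.keys \<omega>. s j powi Poly_Mapping.lookup \<omega> j) \<noteq> 0"
proof -
  have "s j \<noteq> 0" if "j \<in> Poly_Mapping.keys \<omega>" for j
    using assms that by (fastforce simp: Pi_iff)
  then show ?thesis
    by simp
qed

text \<open>
  The number \<open>c \<omega>\<close> is the coefficient that the exponential of the pairing acquires from
  $a_\omega X^\omega$ on $V_s$. It is positive on $A^+$ and negative on $A^-$, and these two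
  sets exhaust the support since the coefficient never vanishes there.
\<close>

lemma relation_balance:
  assumes x: "x \<in> sign_locus V J f s" and s: "s \<in> J \<rightarrow> {-1, 1}"
    and a: "a \<in> laurent_polys K J"
    and zero: "(\<Sum>\<omega>\<in>Poly_Mapping.keys a. Poly_Mapping.lookup a \<omega> *
      (\<Prod>j\<in>Poly_Mapping.keys \<omega>. f j x powi Poly_Mapping.lookup \<omega> j)) = 0"
  defines "c \<omega> \<equiv> Poly_Mapping.lookup a \<omega> * (\<Prod>j\<in>Poly_Mapping.keys \<omega>. s j powi Poly_Mapping.lookup \<omega> j)"
  shows "(\<Sum>\<omega>\<in>pos_exponents s a. \<bar>c \<omega>\<bar> * exp (pairing (Log_map J f x) \<omega>)) =
    (\<Sum>\<omega>\<in>neg_exponents s a. \<bar>c \<omega>\<bar> * exp (pairing (Log_map J f x) \<omega>))"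
proof -
  let ?e = "\<lambda>\<omega>. exp (pairing (Log_map J f x) \<omega>)"
  have J: "Poly_Mapping.keys \<omega> \<subseteq> J" if "\<omega> \<in> Poly_Mapping.keys a" for \<omega>
    using a that by (auto simp: laurent_polys_def)
  have c: "c \<omega> \<noteq> 0" if "\<omega> \<in> Poly_Mapping.keys a" for \<omega>
    using powi_sign_nonzero[OF s J[OF that]] that by (simp add: c_def in_keys_iff)
  have keys: "Poly_Mapping.keys a = pos_exponents s a \<union> neg_exponents s a"
    unfolding pos_exponents_def neg_exponents_def c_def[symmetric]
    by (use c linorder_neqE in blast)
  have fin: "finite (pos_exponents s a)" "finite (neg_exponents s a)"
    by (simp_all add: pos_exponents_def neg_exponents_def)
  have "0 = (\<Sum>\<omega>\<in>Poly_Mapping.keys a. c \<omega> * ?e \<omega>)"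
    unfolding zero[symmetric] c_def
    by (intro sum.cong) (simp_all add: monomial_eq_sign_times_exp[OF x s J])
  also have "\<dots> = (\<Sum>\<omega>\<in>pos_exponents s a. c \<omega> * ?e \<omega>) + (\<Sum>\<omega>\<in>neg_exponents s a. c \<omega> * ?e \<omega>)"
    unfolding keys using fin
    by (intro sum.union_disjoint) (auto simp: pos_exponents_def neg_exponents_def)
  also have "(\<Sum>\<omega>\<in>pos_exponents s a. c \<omega> * ?e \<omega>) = (\<Sum>\<omega>\<in>pos_exponents s a. \<bar>c \<omega>\<bar> * ?e \<omega>)"
    by (intro sum.cong) (auto simp: pos_exponents_def c_def)
  also have "(\<Sum>\<omega>\<in>neg_exponents s a. c \<omega> * ?e \<omega>) = - (\<Sum>\<omega>\<in>neg_exponents s a. \<bar>c \<omega>\<bar> * ?e \<omega>)"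
    unfolding sum_negf[symmetric] by (intro sum.cong) (auto simp: neg_exponents_def c_def)
  finally show ?thesis by simp
qed

theorem proposition3p4:
  fixes K :: "real set" and n :: nat and V :: "(nat \<Rightarrow> real) set"
    and J :: "'j set" and f :: "'j \<Rightarrow> (nat \<Rightarrow> real) \<Rightarrow> real" and s :: "'j \<Rightarrow> real"
  assumes "subfield K (ring_of_type_algebra :: real ring)" and "countable K"
    and "affine_variety K n V"
    and "generating_family K n V J f"
    and "s \<in> J \<rightarrow> {-1, 1}"
  shows "sign_cone n V J f s \<subseteq>
    (\<Inter>a\<in>relation_ideal K n V J f.
       tropical_locus J (max_pairing (pos_exponents s a)) (max_pairing (neg_exponents s a)))"
proof (intro subsetI INT_I)
  fix v a
  assume v: "v \<in> sign_cone n V J f s" and a: "a \<in> relation_ideal K n V J f"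
  note K = assms(1) and V = assms(3) and gen = assms(4) and s = assms(5)
  have aL: "a \<in> laurent_polys K J"
    using a by (simp add: relation_ideal_def)
  obtain x t where x: "\<And>i. x i \<in> sign_locus V J f s" and t: "filterlim t at_top sequentially"
    and lim: "\<And>j. j \<in> J \<Longrightarrow> (\<lambda>i. Log_map J f (x i) j / t i) \<longlonglongrightarrow> v j"
    using sign_cone_asymptotic[OF subfield_consts(2)[OF K] coord_ring_cring[OF K gen] V gen v]
    by metis
  let ?P = "pos_exponents s a" and ?N = "neg_exponents s a"
  let ?c = "\<lambda>\<omega>. \<bar>Poly_Mapping.lookup a \<omega> *
    (\<Prod>j\<in>Poly_Mapping.keys \<omega>. s j powi Poly_Mapping.lookup \<omega> j)\<bar>"
  have "x i \<in> nonvanishing_locus V J f" for i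
    using x[of i] by (auto simp: sign_locus_def nonvanishing_locus_def)
  then have balance: "(\<Sum>\<omega>\<in>?P. ?c \<omega> * exp (pairing (Log_map J f (x i)) \<omega>)) =
      (\<Sum>\<omega>\<in>?N. ?c \<omega> * exp (pairing (Log_map J f (x i)) \<omega>))" for i
    by (rule relation_balance[OF x s aL relation_vanishes[OF K gen a]])
  have fin: "finite ?P" "finite ?N"
    by (simp_all add: pos_exponents_def neg_exponents_def)
  have pos: "?c \<omega> > 0" if "\<omega> \<in> ?P \<union> ?N" for \<omega>
    using that unfolding pos_exponents_def neg_exponents_def zero_less_abs_iff
    by (metis (no_types, lifting) UnE mem_Collect_eq less_irrefl)
  have lim': "(\<lambda>i. Log_map J f (x i) j / t i) \<longlonglongrightarrow> v j"
    if "\<omega> \<in> ?P \<union> ?N" "j \<in> Poly_Mapping.keys \<omega>" for \<omega> j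
    using that aL by (intro lim) (auto simp: laurent_polys_def pos_exponents_def neg_exponents_def)
  have "max_pairing ?P v \<le> max_pairing ?N v"
  proof (rule max_pairing_le_of_exp_sum_le[where r = "\<lambda>i. Log_map J f (x i)", OF fin _ t sequentially_bot])
    show "(\<Sum>\<omega>\<in>?P. ?c \<omega> * exp (pairing (Log_map J f (x i)) \<omega>)) \<le>
        (\<Sum>\<omega>\<in>?N. ?c \<omega> * exp (pairing (Log_map J f (x i)) \<omega>))" for i
      using balance[of i] by (rule eq_refl)
  qed (use pos lim' in blast)+
  moreover have "max_pairing ?N v \<le> max_pairing ?P v"
  proof (rule max_pairing_le_of_exp_sum_le[where r = "\<lambda>i. Log_map J f (x i)", OF fin(2,1) _ t sequentially_bot])
    show "(\<Sum>\<omega>\<in>?N. ?c \<omega> * exp (pairing (Log_map J f (x i)) \<omega>)) \<le>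
        (\<Sum>\<omega>\<in>?P. ?c \<omega> * exp (pairing (Log_map J f (x i)) \<omega>))" for i
      using balance[of i, symmetric] by (rule eq_refl)
  qed (use pos lim' in blast)+
  moreover have "v \<in> topspace (powertop_real J)"
    using v by (auto simp: sign_cone_def punctured_space_def origin_def split: if_splits)
  ultimately show "v \<in> tropical_locus J (max_pairing ?P) (max_pairing ?N)"
    by (simp add: tropical_locus_def)
qed

end
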